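(* Let $f^0(x,y)$ be a curvature surface on $D=\{(x,y)\in\mathbb{R}^2:x>0\}$ with frame field $F^0=[\phi,X^0_\alpha,X^0_\beta,\xi]$, normalized so that for some point $p_0=(x_0,0)\in D$ one has $f^0(p_0)=\boldsymbol{0}$ and $F^0(p_0)=\mathrm{Id}$. Let $B$ be the diagonal matrix $B=\mathrm{diag}(-1,1,1,1)$. Then for all $x>0$ and $y\ge0$ $$B f^0(x,y)=f^0(x,-y),\qquad B\phi(x,y)=-\phi(x,-y),\qquad B\xi(x,y)=\xi(x,-y).$$ Furthermore $B\tilde{\boldsymbol{u}}(x)=\tilde{\boldsymbol{u}}(x)$ and $B\tilde A(x)=\tilde A(x)$ hold, where $\tilde{\boldsymbol{u}}(x)=(B_2^2+C_2^2)^{-1/2}(x)(-B_2X^0_\alpha+C_2\xi)(x,y)$ (independent of $y$) and $\tilde A(x)=f^0(x,y)-(B_2^2+C_2^2)^{-1}(x)(B_2\xi+C_2X^0_\alpha)(x,y)$ (independent of $y$).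
   Context: $X_0(x)=\frac52+\sum_{k\ge1}a_kx^{2k}$ (analytic on $\mathbb{R}$), $a_1=1$, $2(k+1)(4k^2+\frac54)a_{k+1}+(2k-1)a_k=0$ $(k\ge1)$. $h(x,y)=2X_0-xX_0'+y^2\frac{X_0'}{x}+\sqrt5$ (positive). $B_2(x)=-\frac12\frac{X_0'}{x}-\sqrt5$, $C_2(x)=X_0''-\frac{X_0'}{x}$. On $D$ put $a_1=\frac{2y}{xh}(X_0+\frac{\sqrt5}{2})$, $b_1=-\frac{1}{xh}(X_0+\frac{\sqrt5}{2}+\sqrt5(x^2-y^2))$, $c_1=-\frac{2}{xh}(X_0+\frac{\sqrt5}{2})$, $a_2=-\frac1h(2X_0+\sqrt5-(x^2+y^2)\frac{X_0'}{x})$, $b_2=-\frac{2y}{h}(\frac{X_0'}{2x}+\sqrt5)$, $c_2=\frac{2y}{h}(X_0''-\frac{X_0'}{x})$. The frame field is an analytic orthonormal frame field $F^0=[\phi,X^0_\alpha,X^0_\beta,\xi]$ of $\mathbb{R}^4$ on $D$ (regarded as a $4\times4$ matrix with these columns) satisfying $\phi_x=-a_1X^0_\alpha$, $\xi_x=b_1X^0_\alpha$, $(X^0_\beta)_x=c_1X^0_\alpha$, $(X^0_\alpha)_x=a_1\phi-b_1\xi-c_1X^0_\beta$, $\phi_y=-a_2X^0_\beta$, $\xi_y=b_2X^0_\beta$, $(X^0_\alpha)_y=c_2X^0_\beta$, $(X^0_\beta)_y=a_2\phi-b_2\xi-c_2X^0_\alpha$ (it exists and is unique up to left multiplication by a constant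 orthogonal matrix). The curvature surface $f^0:D\to\mathbb{R}^4$ determined by $F^0$ is the analytic map, unique up to translation, with $df^0=\frac{x^2-y^2}{xh}X^0_\alpha dx+\frac{2y}{h}X^0_\beta dy$. Each $y$-curve of $f^0$ lies on a $2$-sphere with center $\tilde A(x)$ in a hyperplane perpendicular to $\tilde{\boldsymbol{u}}(x)$. *)

theory Defs
  imports "HOL-Analysis.Analysis"
begin

section \<open>Real analytic maps of two real variables\<close>

text \<open>Local expansion in a double power series; \<open>has_sum\<close> is unconditional summation.\<close>

definition real_analytic_on :: "(real \<times> real \<Rightarrow> 'a::real_normed_vector) \<Rightarrow> (real \<times> real) set \<Rightarrow> bool"
  where "real_analytic_on f S \<longleftrightarrow>
    (\<forall>p\<in>S. \<exists>r>0. \<exists>c :: nat \<Rightarrow> nat \<Rightarrow> 'a. \<forall>u v. \<bar>u\<bar> < r \<longrightarrow> \<bar>v\<bar> < r \<longrightarrow>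
       ((\<lambda>(i, j). (u ^ i * v ^ j) *\<^sub>R c i j) has_sum f (p + (u, v))) UNIV)"

section \<open>The function \<open>X\<^sub>0\<close> and the coefficient functions\<close>

text \<open>The entry at 0 is a dummy: the sequence starts at index 1, and the constant
  term 5/2 is written separately in \<open>X0\<close>.\<close>

fun X0_coeff :: "nat \<Rightarrow> real" where
  "X0_coeff 0 = 0"
| "X0_coeff (Suc 0) = 1"
| "X0_coeff (Suc (Suc n)) =
     - (2 * real (Suc n) - 1) * X0_coeff (Suc n)
       / (2 * (real (Suc n) + 1) * (4 * real (Suc n) ^ 2 + 5/4))"

lemma X0_coeff_recurrence:
  assumes "k \<ge> 1"
  shows "2 * (real k + 1) * (4 * real k ^ 2 + 5/4) * X0_coeff (k + 1)
           + (2 * real k - 1) * X0_coeff k = 0"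
proof -
  obtain n where k: "k = Suc n"
    using assms by (cases k) auto
  define d where "d = 2 * (real k + 1) * (4 * real k ^ 2 + 5/4)"
  have "d > 0"
    unfolding d_def by (intro mult_pos_pos add_nonneg_pos) auto
  moreover have "X0_coeff (k + 1) = - (2 * real k - 1) * X0_coeff k / d"
    unfolding d_def k Suc_eq_plus1[symmetric] by (rule X0_coeff.simps(3))
  ultimately have "d * X0_coeff (k + 1) + (2 * real k - 1) * X0_coeff k = 0"
    by (simp add: left_diff_distrib)
  then show ?thesis
    by (simp only: d_def)
qed

definition X0 :: "real \<Rightarrow> real" where
  "X0 x = 5/2 + (\<Sum>k. X0_coeff (Suc k) * x ^ (2 * Suc k))"

abbreviation X0' :: "real \<Rightarrow> real" where "X0' \<equiv> deriv X0"
abbreviation X0'' :: "real \<Rightarrow> real" where "X0'' \<equiv> deriv X0'"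

definition h :: "real \<Rightarrow> real \<Rightarrow> real" where
  "h x y = 2 * X0 x - x * X0' x + y^2 * (X0' x / x) + sqrt 5"

definition B2 :: "real \<Rightarrow> real" where
  "B2 x = - (1/2) * (X0' x / x) - sqrt 5"

definition C2 :: "real \<Rightarrow> real" where
  "C2 x = X0'' x - X0' x / x"

definition a1 :: "real \<Rightarrow> real \<Rightarrow> real" where
  "a1 x y = 2 * y / (x * h x y) * (X0 x + sqrt 5 / 2)"

definition b1 :: "real \<Rightarrow> real \<Rightarrow> real" where
  "b1 x y = - (1 / (x * h x y)) * (X0 x + sqrt 5 / 2 + sqrt 5 * (x^2 - y^2))"

definition c1 :: "real \<Rightarrow> real \<Rightarrow> real" where
  "c1 x y = - (2 / (x * h x y)) * (X0 x + sqrt 5 / 2)"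

definition a2 :: "real \<Rightarrow> real \<Rightarrow> real" where
  "a2 x y = - (1 / h x y) * (2 * X0 x + sqrt 5 - (x^2 + y^2) * (X0' x / x))"

definition b2 :: "real \<Rightarrow> real \<Rightarrow> real" where
  "b2 x y = - (2 * y / h x y) * (X0' x / (2 * x) + sqrt 5)"

definition c2 :: "real \<Rightarrow> real \<Rightarrow> real" where
  "c2 x y = 2 * y / h x y * (X0'' x - X0' x / x)"

section \<open>Frame field and curvature surface\<close>

definition D :: "(real \<times> real) set" where
  "D = {(x, y). x > 0}"

text \<open>A frame is the matrix with columns \<open>\<phi>, X\<^sub>\<alpha>, X\<^sub>\<beta>, \<xi>\<close>, in this order.\<close>

definition \<phi> :: "(real \<times> real \<Rightarrow> real^4^4) \<Rightarrow> real \<times> real \<Rightarrow> real^4" where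
  "\<phi> F p = column 1 (F p)"

definition X\<alpha> :: "(real \<times> real \<Rightarrow> real^4^4) \<Rightarrow> real \<times> real \<Rightarrow> real^4" where
  "X\<alpha> F p = column 2 (F p)"

definition X\<beta> :: "(real \<times> real \<Rightarrow> real^4^4) \<Rightarrow> real \<times> real \<Rightarrow> real^4" where
  "X\<beta> F p = column 3 (F p)"

definition \<xi> :: "(real \<times> real \<Rightarrow> real^4^4) \<Rightarrow> real \<times> real \<Rightarrow> real^4" where
  "\<xi> F p = column 4 (F p)"

definition has_partial_x :: "(real \<times> real \<Rightarrow> real^4) \<Rightarrow> real^4 \<Rightarrow> real \<times> real \<Rightarrow> bool" where
  "has_partial_x g v p \<longleftrightarrow> ((\<lambda>s. g (s, snd p)) has_vector_derivative v) (at (fst p))"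

definition has_partial_y :: "(real \<times> real \<Rightarrow> real^4) \<Rightarrow> real^4 \<Rightarrow> real \<times> real \<Rightarrow> bool" where
  "has_partial_y g v p \<longleftrightarrow> ((\<lambda>t. g (fst p, t)) has_vector_derivative v) (at (snd p))"

definition frame_field :: "(real \<times> real \<Rightarrow> real^4^4) \<Rightarrow> bool" where
  "frame_field F \<longleftrightarrow>
     real_analytic_on F D \<and>
     (\<forall>p\<in>D. orthogonal_matrix (F p)) \<and>
     (\<forall>(x, y)\<in>D.
        has_partial_x (\<phi> F) (- a1 x y *\<^sub>R X\<alpha> F (x, y)) (x, y) \<and>
        has_partial_x (\<xi> F) (b1 x y *\<^sub>R X\<alpha> F (x, y)) (x, y) \<and>
        has_partial_x (X\<beta> F) (c1 x y *\<^sub>R X\<alpha> F (x, y)) (x, y) \<and>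
        has_partial_x (X\<alpha> F)
          (a1 x y *\<^sub>R \<phi> F (x, y) - b1 x y *\<^sub>R \<xi> F (x, y) - c1 x y *\<^sub>R X\<beta> F (x, y)) (x, y) \<and>
        has_partial_y (\<phi> F) (- a2 x y *\<^sub>R X\<beta> F (x, y)) (x, y) \<and>
        has_partial_y (\<xi> F) (b2 x y *\<^sub>R X\<beta> F (x, y)) (x, y) \<and>
        has_partial_y (X\<alpha> F) (c2 x y *\<^sub>R X\<beta> F (x, y)) (x, y) \<and>
        has_partial_y (X\<beta> F)
          (a2 x y *\<^sub>R \<phi> F (x, y) - b2 x y *\<^sub>R \<xi> F (x, y) - c2 x y *\<^sub>R X\<alpha> F (x, y)) (x, y))"

definition curvature_surface ::
    "(real \<times> real \<Rightarrow> real^4^4) \<Rightarrow> (real \<times> real \<Rightarrow> real^4) \<Rightarrow> bool" where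
  "curvature_surface F f \<longleftrightarrow>
     real_analytic_on f D \<and>
     (\<forall>(x, y)\<in>D.
        (f has_derivative
          (\<lambda>(dx, dy). ((x^2 - y^2) / (x * h x y) * dx) *\<^sub>R X\<alpha> F (x, y)
                     + (2 * y / h x y * dy) *\<^sub>R X\<beta> F (x, y))) (at (x, y)))"

section \<open>Normal vectors and centers of the spheres containing the \<open>y\<close>-curves\<close>

text \<open>Given as functions of \<open>(x, y)\<close>; that they depend on \<open>x\<close> only is a theorem about
  frame fields and curvature surfaces.\<close>

definition u_tilde :: "(real \<times> real \<Rightarrow> real^4^4) \<Rightarrow> real \<times> real \<Rightarrow> real^4" where
  "u_tilde F = (\<lambda>(x, y). ((B2 x)^2 + (C2 x)^2) powr (- 1/2) *\<^sub>R
     (- B2 x *\<^sub>R X\<alpha> F (x, y) + C2 x *\<^sub>R \<xi> F (x, y)))"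

definition A_tilde ::
    "(real \<times> real \<Rightarrow> real^4^4) \<Rightarrow> (real \<times> real \<Rightarrow> real^4) \<Rightarrow> real \<times> real \<Rightarrow> real^4" where
  "A_tilde F f = (\<lambda>(x, y). f (x, y) - inverse ((B2 x)^2 + (C2 x)^2) *\<^sub>R
     (B2 x *\<^sub>R \<xi> F (x, y) + C2 x *\<^sub>R X\<alpha> F (x, y)))"

definition B :: "real^4^4" where
  "B = (\<chi> i j. if i = j then (if i = 1 then - 1 else 1) else 0)"

end

theory Submission
  imports Defs
begin

text \<open>
  Conjugating with \<open>B\<close> and reflecting \<open>y \<mapsto> - y\<close> maps solutions of the structure equations to
  solutions, because \<open>a\<^sub>1, b\<^sub>2, c\<^sub>2\<close> are odd in \<open>y\<close> and the other coefficients are even.  Uniqueness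
  holds since the equations are skew, so that the total square length of the difference of two
  solutions is constant.  The \<open>y\<close>-derivatives of \<open>u_tilde\<close> and \<open>A_tilde\<close> vanish formally, except that
  \<open>A_tilde\<close> needs \<open>B\<^sub>2\<^sup>2 + C\<^sub>2\<^sup>2 \<noteq> 0\<close>.  This follows from \<open>X\<^sub>0'(x) / x > 0\<close>: with
  \<open>X\<^sub>0'(x) / x = 2 w(x\<^sup>2)\<close> and \<open>\<theta> = z d/dz\<close>, the recurrence reads
  \<open>8 \<theta>\<^sup>3 w + (5/2 + 2 z) \<theta> w + z w = 0\<close>.  This is the equation satisfied by products of two
  solutions of a Bessel equation, and it has the first integral
  \<open>8 w \<theta>\<^sup>2w - 4 (\<theta> w)\<^sup>2 + (z + 5/4) w\<^sup>2\<close>, whose value is \<open>5/4\<close>; hence \<open>w\<close> has no zero.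
\<close>

section \<open>Positivity of \<open>X\<^sub>0'(x) / x\<close>\<close>

text \<open>The recurrence divides by \<open>k + 1\<close> and multiplies by a factor of absolute
  value at most 1, because 2k - 1 \<le> 2(4k^2 + 5/4). Comparison with the exponential series then
  gives convergence on the whole line.\<close>

lemma abs_X0_coeff_le: "\<bar>X0_coeff n\<bar> \<le> inverse (fact n)"
proof (induction n rule: X0_coeff.induct)
  case (3 n)
  define k where "k = real (Suc n)"
  have k: "k \<ge> 1"
    by (simp add: k_def)
  have d: "4 * k ^ 2 + 5/4 > 0"
    by (intro add_nonneg_pos) auto
  have "k \<le> k ^ 2"
    using k by (simp add: power2_eq_square)
  then have le: "2 * k - 1 \<le> 2 * (4 * k ^ 2 + 5/4)"
    unfolding distrib_left using k by simp
  have "\<bar>X0_coeff (Suc (Suc n))\<bar>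
      = (2 * k - 1) / (2 * (4 * k ^ 2 + 5/4)) / (k + 1) * \<bar>X0_coeff (Suc n)\<bar>"
    unfolding X0_coeff.simps(3) k_def[symmetric] abs_mult abs_divide abs_minus_cancel
    using k d by (simp add: field_simps)
  also have "\<dots> \<le> 1 / (k + 1) * inverse (fact (Suc n))"
  proof (intro mult_mono 3 divide_right_mono)
    show "(2 * k - 1) / (2 * (4 * k ^ 2 + 5/4)) \<le> 1"
      using le d by (simp add: divide_le_eq)
  qed (use k in auto)
  also have "\<dots> = inverse (fact (Suc (Suc n)))"
    by (simp add: k_def divide_simps)
  finally show ?case .
qed auto

lemma summable_X0_coeff: "summable (\<lambda>n. X0_coeff n * z ^ n)"
proof (rule summable_comparison_test')
  show "summable (\<lambda>n. inverse (fact n) * \<bar>z\<bar> ^ n)"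
    by (rule summable_exp)
  show "norm (X0_coeff n * z ^ n) \<le> inverse (fact n) * \<bar>z\<bar> ^ n" for n
    unfolding real_norm_def abs_mult power_abs by (intro mult_right_mono abs_X0_coeff_le) auto
qed

text \<open>The power series of \<open>\<theta>\<^sup>j w\<close>, where \<open>w\<close> is the power series with coefficients
  \<open>(n + 1) a\<^sub>n\<^sub>+\<^sub>1\<close> and \<open>\<theta> = z d/dz\<close>.\<close>

definition euler_series :: "nat \<Rightarrow> real \<Rightarrow> real" where
  "euler_series j z = (\<Sum>n. real n ^ j * diffs X0_coeff n * z ^ n)"

text \<open>Passing from \<open>j\<close> to \<open>Suc j\<close> is termwise differentiation
  followed by multiplication with \<open>z\<close>; both preserve convergence everywhere.\<close>

lemma summable_euler: "summable (\<lambda>n. real n ^ j * diffs X0_coeff n * z ^ n)"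
proof (induction j arbitrary: z)
  case 0
  then show ?case
    using termdiff_converges_all[OF summable_X0_coeff] by simp
next
  case (Suc j)
  let ?c = "\<lambda>n. real n ^ j * diffs X0_coeff n"
  have "summable (\<lambda>n. diffs ?c n * z ^ n)"
    by (rule termdiff_converges_all) (rule Suc)
  then have "summable (\<lambda>n. real n * ?c n * z ^ (n - Suc 0))"
    using diffs_equiv sums_summable by blast
  then have "summable (\<lambda>n. real n * ?c n * z ^ (n - Suc 0) * z)"
    by (rule summable_mult2)
  also have "(\<lambda>n. real n * ?c n * z ^ (n - Suc 0) * z) = (\<lambda>n. real n ^ Suc j * diffs X0_coeff n * z ^ n)"
  proof
    \<comment> \<open>At \<open>n = 0\<close> the truncated exponent \<open>n - Suc 0\<close> does
      no harm, since the factor \<open>real n\<close> kills the term.\<close>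
    show "real n * ?c n * z ^ (n - Suc 0) * z = real n ^ Suc j * diffs X0_coeff n * z ^ n" for n
      by (cases n) (auto simp: mult_ac)
  qed
  finally show ?case .
qed

lemma sums_euler: "(\<lambda>n. real n ^ j * diffs X0_coeff n * z ^ n) sums euler_series j z"
  unfolding euler_series_def using summable_euler by (rule summable_sums)

text \<open>The product form \<open>z * d\<close> instead of a quotient covers \<open>z = 0\<close>
  as well, so that continuity at the origin follows too.\<close>

lemma euler_series_deriv:
  obtains d where "(euler_series j has_real_derivative d) (at z)" "z * d = euler_series (Suc j) z"
proof
  let ?c = "\<lambda>n. real n ^ j * diffs X0_coeff n"
  let ?d = "\<Sum>n. diffs ?c n * z ^ n"
  show "(euler_series j has_real_derivative ?d) (at z)"
    unfolding euler_series_def[abs_def]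
    by (rule termdiffs_strong_converges_everywhere) (rule summable_euler)
  have "(\<lambda>n. real n * ?c n * z ^ (n - Suc 0)) sums ?d"
    by (intro diffs_equiv termdiff_converges_all summable_euler)
  then have "(\<lambda>n. z * (real n * ?c n * z ^ (n - Suc 0))) sums (z * ?d)"
    by (rule sums_mult)
  also have "(\<lambda>n. z * (real n * ?c n * z ^ (n - Suc 0))) = (\<lambda>n. real n ^ Suc j * diffs X0_coeff n * z ^ n)"
  proof
    show "z * (real n * ?c n * z ^ (n - Suc 0)) = real n ^ Suc j * diffs X0_coeff n * z ^ n" for n
      by (cases n) (auto simp: mult_ac)
  qed
  finally show "z * ?d = euler_series (Suc j) z"
    using sums_euler sums_unique2 by blast
qed

lemma continuous_on_euler_series: "continuous_on S (euler_series j)"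
proof (rule continuous_at_imp_continuous_on, rule ballI)
  show "isCont (euler_series j) z" for z
    by (rule euler_series_deriv[of j z]) (rule DERIV_isCont)
qed

section \<open>The third-order equation for w and its first integral\<close>

lemma euler_series_0: "euler_series j 0 = 0 ^ j"
proof -
  have "euler_series j 0 = real 0 ^ j * diffs X0_coeff 0"
    unfolding euler_series_def by (rule powser_zero)
  then show ?thesis
    by (simp add: diffs_def)
qed

text \<open>Comparison of coefficients: the coefficient of z^k is the recurrence for a_k and a_(k+1)
  multiplied by k, where k = n + 1.\<close>

lemma euler_series_ode:
  "8 * euler_series 3 z + 5/2 * euler_series 1 z + z * (2 * euler_series 1 z + euler_series 0 z) = 0"
proof -
  let ?q = "diffs X0_coeff"
  let ?s = "\<lambda>n. (8 * real n ^ 3 + 5/2 * real n) * ?q n * z ^ n"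
  let ?t = "\<lambda>n. (2 * real n + 1) * ?q n * z ^ Suc n"
  have "(\<lambda>n. 8 * (real n ^ 3 * ?q n * z ^ n) + 5/2 * (real n ^ 1 * ?q n * z ^ n)) sums
      (8 * euler_series 3 z + 5/2 * euler_series 1 z)"
    by (intro sums_add sums_mult sums_euler)
  moreover have "(\<lambda>n. 8 * (real n ^ 3 * ?q n * z ^ n) + 5/2 * (real n ^ 1 * ?q n * z ^ n)) = ?s"
    by (simp add: fun_eq_iff algebra_simps)
  ultimately have "?s sums (8 * euler_series 3 z + 5/2 * euler_series 1 z)"
    by simp
  \<comment> \<open>The term of \<open>?s\<close> at index 0 vanishes; dropping it aligns the powers
    of \<open>z\<close> with those of \<open>?t\<close>.\<close>
  then have s: "(\<lambda>n. ?s (Suc n)) sums (8 * euler_series 3 z + 5/2 * euler_series 1 z)"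
    by (subst sums_Suc_iff) simp
  have "(\<lambda>n. z * (2 * (real n ^ 1 * ?q n * z ^ n) + real n ^ 0 * ?q n * z ^ n)) sums
      (z * (2 * euler_series 1 z + euler_series 0 z))"
    by (intro sums_add sums_mult sums_euler)
  moreover have "(\<lambda>n. z * (2 * (real n ^ 1 * ?q n * z ^ n) + real n ^ 0 * ?q n * z ^ n)) = ?t"
    by (simp add: fun_eq_iff algebra_simps)
  ultimately have t: "?t sums (z * (2 * euler_series 1 z + euler_series 0 z))"
    by simp
  have "?s (Suc n) + ?t n = 0" for n
  proof -
    let ?k = "real (Suc n)"
    have "2 * (?k + 1) * (4 * ?k ^ 2 + 5/4) * X0_coeff (Suc n + 1)
           + (2 * ?k - 1) * X0_coeff (Suc n) = 0"
      by (rule X0_coeff_recurrence) simp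
    moreover have "2 * (?k + 1) * (4 * ?k ^ 2 + 5/4) = (?k + 1) * (8 * ?k ^ 2 + 5/2)"
      by (simp add: field_simps)
    ultimately have "((?k + 1) * (8 * ?k ^ 2 + 5/2) * X0_coeff (Suc n + 1)
           + (2 * ?k - 1) * X0_coeff (Suc n)) * (?k * z ^ Suc n) = 0"
      by (simp only: mult_zero_left)
    moreover have "?s (Suc n) + ?t n = ((?k + 1) * (8 * ?k ^ 2 + 5/2) * X0_coeff (Suc n + 1)
           + (2 * ?k - 1) * X0_coeff (Suc n)) * (?k * z ^ Suc n)"
      unfolding diffs_def
      by (simp add: algebra_simps power2_eq_square power3_eq_cube del: X0_coeff.simps(3))
    ultimately show ?thesis
      by (simp only:)
  qed
  then have "(\<lambda>n. ?s (Suc n) + ?t n) sums 0"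
    by simp
  with sums_add[OF s t] show ?thesis
    by (rule sums_unique2)
qed

text \<open>Applying \<theta> to the left-hand side, the products of \<theta>w with \<theta>^2 w
  cancel and what remains is w times the third-order equation. At the origin w = 1 and \<theta>w =
  \<theta>^2 w = 0, which gives the value 5/4.\<close>

lemma euler_series_first_integral:
  assumes "z \<ge> 0"
  shows "8 * euler_series 0 z * euler_series 2 z - 4 * (euler_series 1 z)\<^sup>2
           + (z + 5/4) * (euler_series 0 z)\<^sup>2 = 5/4"
proof -
  define E where "E t = 8 * euler_series 0 t * euler_series 2 t - 4 * (euler_series 1 t)\<^sup>2
           + (t + 5/4) * (euler_series 0 t)\<^sup>2" for t
  have deriv: "(E has_real_derivative 0) (at t)" if "t > 0" for t
  proof -
    obtain d0 where d0: "(euler_series 0 has_real_derivative d0) (at t)" "t * d0 = euler_series 1 t"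
      using euler_series_deriv[of 0 t] by auto
    obtain d1 where d1: "(euler_series 1 has_real_derivative d1) (at t)" "t * d1 = euler_series 2 t"
      using euler_series_deriv[of 1 t] by (metis Suc_1)
    obtain d2 where d2: "(euler_series 2 has_real_derivative d2) (at t)" "t * d2 = euler_series 3 t"
      using euler_series_deriv[of 2 t] by (metis eval_nat_numeral(3))
    let ?d = "8 * (d0 * euler_series 2 t + euler_series 0 t * d2) - 8 * euler_series 1 t * d1
           + (euler_series 0 t)\<^sup>2 + (t + 5/4) * (2 * euler_series 0 t * d0)"
    have "(E has_real_derivative ?d) (at t)"
      unfolding E_def[abs_def]
      by (rule derivative_eq_intros d0(1) d1(1) d2(1) refl | simp add: algebra_simps)+
    moreover have "t * ?d = euler_series 0 t * (8 * euler_series 3 t + 5/2 * euler_series 1 t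
        + t * (2 * euler_series 1 t + euler_series 0 t))"
      by (simp only: d0(2)[symmetric] d1(2)[symmetric] d2(2)[symmetric])
        (simp add: algebra_simps power2_eq_square)
    then have "t * ?d = 0"
      by (simp only: euler_series_ode mult_zero_right)
    then have "?d = 0"
      using that by (simp only: mult_eq_0_iff) auto
    ultimately show ?thesis
      by metis
  qed
  have "E z = E 0"
  proof (cases "z = 0")
    case False
    \<comment> \<open>The derivative was obtained after cancelling \<open>t\<close>, hence only for
      \<open>t > 0\<close>; continuity carries the constant value to the endpoint 0.\<close>
    have "continuous_on {0..z} E"
      unfolding E_def[abs_def] by (intro continuous_intros continuous_on_euler_series)
    then show ?thesis
      using False assms by (intro DERIV_isconst_end[of 0 z E]) (auto intro: deriv)
  qed simp
  then show ?thesis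
    by (simp add: E_def euler_series_0)
qed

text \<open>Since w(0) = 1, a nonpositive value would force a zero of w by the intermediate value
  theorem. At a zero the first integral reads -4 (\<theta>w)^2 = 5/4, which is impossible.\<close>

lemma euler_series_pos:
  assumes "z \<ge> 0"
  shows "euler_series 0 z > 0"
proof (rule ccontr)
  assume "\<not> euler_series 0 z > 0"
  then have "\<exists>t\<ge>0. t \<le> z \<and> euler_series 0 t = 0"
    using assms by (intro IVT2') (auto simp: euler_series_0 continuous_on_euler_series)
  then obtain t where "t \<ge> 0" "euler_series 0 t = 0"
    by blast
  with euler_series_first_integral[of t] have "- 4 * (euler_series 1 t)\<^sup>2 = 5/4"
    by simp
  then show False
    using zero_le_power2[of "euler_series 1 t"] by linarith
qed

lemma deriv_X0: "X0' x = 2 * x * euler_series 0 (x\<^sup>2)"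
proof (rule DERIV_imp_deriv)
  let ?P = "\<lambda>z. \<Sum>n. X0_coeff n * z ^ n"
  have P: "(?P has_real_derivative euler_series 0 z) (at z)" for z
  proof -
    have "(?P has_real_derivative (\<Sum>n. diffs X0_coeff n * z ^ n)) (at z)"
      by (rule termdiffs_strong_converges_everywhere) (rule summable_X0_coeff)
    then show ?thesis
      by (simp add: euler_series_def)
  qed
  \<comment> \<open>The dummy coefficient at index 0 is 0, so the full series in x^2 agrees with the
    shifted one in \<open>X0\<close>.\<close>
  have "X0 = (\<lambda>x. 5/2 + ?P (x\<^sup>2))"
  proof
    fix x
    show "X0 x = 5/2 + ?P (x\<^sup>2)"
      unfolding X0_def
      using suminf_split_head[OF summable_X0_coeff[of "x\<^sup>2"]] by (simp only: power_mult) simp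
  qed
  moreover have "((\<lambda>x. 5/2 + ?P (x\<^sup>2)) has_real_derivative 2 * x * euler_series 0 (x\<^sup>2)) (at x)"
    by (rule derivative_eq_intros DERIV_chain2[OF P] refl | simp)+
  ultimately show "(X0 has_real_derivative 2 * x * euler_series 0 (x\<^sup>2)) (at x)"
    by simp
qed

text \<open>X0'(x)/x = 2 w(x^2) is positive, so both summands of \<open>B2\<close> are negative.
  This makes the \<open>inverse\<close> in \<open>A_tilde\<close> a genuine reciprocal.\<close>

lemma B2_C2_pos:
  assumes "x > 0"
  shows "(B2 x)\<^sup>2 + (C2 x)\<^sup>2 > 0"
proof -
  have "X0' x / x > 0"
    using assms euler_series_pos[of "x\<^sup>2"] by (simp add: deriv_X0)
  then have "B2 x < 0"
    unfolding B2_def using real_sqrt_ge_zero[of 5] by linarith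
  then show ?thesis
    by (intro add_pos_nonneg) auto
qed

section \<open>Symmetry of the frame\<close>

text \<open>In the derivative of the total square length \<open>N\<close> each coefficient occurs
  twice with opposite signs, so \<open>N\<close> is constant and keeps its initial value 0. The
  distinguished vector \<open>q\<close>, to which the other three are coupled, will be the
  difference of two \<open>X\<alpha>\<close> along x-lines and of two \<open>X\<beta>\<close> along
  y-lines.\<close>

lemma skew_system_zero:
  fixes p q r w :: "real \<Rightarrow> 'a::real_inner"
  assumes "convex S"
    and p: "\<And>s. s \<in> S \<Longrightarrow> (p has_vector_derivative - a s *\<^sub>R q s) (at s within S)"
    and w: "\<And>s. s \<in> S \<Longrightarrow> (w has_vector_derivative b s *\<^sub>R q s) (at s within S)"
    and r: "\<And>s. s \<in> S \<Longrightarrow> (r has_vector_derivative c s *\<^sub>R q s) (at s within S)"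
    and q: "\<And>s. s \<in> S \<Longrightarrow>
      (q has_vector_derivative a s *\<^sub>R p s - b s *\<^sub>R w s - c s *\<^sub>R r s) (at s within S)"
    and "s0 \<in> S" "p s0 = 0" "q s0 = 0" "r s0 = 0" "w s0 = 0"
    and "s \<in> S"
  shows "p s = 0 \<and> q s = 0 \<and> r s = 0 \<and> w s = 0"
proof -
  define N where "N s = p s \<bullet> p s + q s \<bullet> q s + r s \<bullet> r s + w s \<bullet> w s" for s
  have "(N has_vector_derivative 0) (at t within S)" if "t \<in> S" for t
    unfolding N_def has_vector_derivative_def
    by (rule has_derivative_eq_rhs,
        (rule derivative_intros p[OF that, unfolded has_vector_derivative_def]
          q[OF that, unfolded has_vector_derivative_def]
          r[OF that, unfolded has_vector_derivative_def]
          w[OF that, unfolded has_vector_derivative_def])+)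
      (auto simp: fun_eq_iff inner_diff_left inner_diff_right inner_commute algebra_simps)
  then obtain k where "\<And>t. t \<in> S \<Longrightarrow> N t = k"
    using has_vector_derivative_zero_constant[OF \<open>convex S\<close>] by metis
  then have "N s = N s0"
    using assms by simp
  then have "p s \<bullet> p s + q s \<bullet> q s + r s \<bullet> r s + w s \<bullet> w s = 0"
    using assms by (simp add: N_def)
  moreover have "p s \<bullet> p s \<ge> 0" "q s \<bullet> q s \<ge> 0" "r s \<bullet> r s \<ge> 0" "w s \<bullet> w s \<ge> 0"
    by simp_all
  ultimately have "p s \<bullet> p s = 0" "q s \<bullet> q s = 0" "r s \<bullet> r s = 0" "w s \<bullet> w s = 0"
    by linarith+
  then show ?thesis
    by simp
qed

section \<open>Uniqueness of the frame given its value at one point\<close>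

definition structure_equations :: "(real \<times> real \<Rightarrow> real^4^4) \<Rightarrow> bool" where
  "structure_equations F \<longleftrightarrow>
     (\<forall>(x, y)\<in>D.
        has_partial_x (\<phi> F) (- a1 x y *\<^sub>R X\<alpha> F (x, y)) (x, y) \<and>
        has_partial_x (\<xi> F) (b1 x y *\<^sub>R X\<alpha> F (x, y)) (x, y) \<and>
        has_partial_x (X\<beta> F) (c1 x y *\<^sub>R X\<alpha> F (x, y)) (x, y) \<and>
        has_partial_x (X\<alpha> F)
          (a1 x y *\<^sub>R \<phi> F (x, y) - b1 x y *\<^sub>R \<xi> F (x, y) - c1 x y *\<^sub>R X\<beta> F (x, y)) (x, y) \<and>
        has_partial_y (\<phi> F) (- a2 x y *\<^sub>R X\<beta> F (x, y)) (x, y) \<and>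
        has_partial_y (\<xi> F) (b2 x y *\<^sub>R X\<beta> F (x, y)) (x, y) \<and>
        has_partial_y (X\<alpha> F) (c2 x y *\<^sub>R X\<beta> F (x, y)) (x, y) \<and>
        has_partial_y (X\<beta> F)
          (a2 x y *\<^sub>R \<phi> F (x, y) - b2 x y *\<^sub>R \<xi> F (x, y) - c2 x y *\<^sub>R X\<alpha> F (x, y)) (x, y))"

lemma frame_field_structure_equations: "frame_field F \<Longrightarrow> structure_equations F"
  by (simp add: frame_field_def structure_equations_def)

lemma structure_equationsD:
  assumes "structure_equations F" "x > 0"
  shows "((\<lambda>s. \<phi> F (s, y)) has_vector_derivative - a1 x y *\<^sub>R X\<alpha> F (x, y)) (at x)"
    and "((\<lambda>s. \<xi> F (s, y)) has_vector_derivative b1 x y *\<^sub>R X\<alpha> F (x, y)) (at x)"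
    and "((\<lambda>s. X\<beta> F (s, y)) has_vector_derivative c1 x y *\<^sub>R X\<alpha> F (x, y)) (at x)"
    and "((\<lambda>s. X\<alpha> F (s, y)) has_vector_derivative
          a1 x y *\<^sub>R \<phi> F (x, y) - b1 x y *\<^sub>R \<xi> F (x, y) - c1 x y *\<^sub>R X\<beta> F (x, y)) (at x)"
    and "((\<lambda>t. \<phi> F (x, t)) has_vector_derivative - a2 x y *\<^sub>R X\<beta> F (x, y)) (at y)"
    and "((\<lambda>t. \<xi> F (x, t)) has_vector_derivative b2 x y *\<^sub>R X\<beta> F (x, y)) (at y)"
    and "((\<lambda>t. X\<alpha> F (x, t)) has_vector_derivative c2 x y *\<^sub>R X\<beta> F (x, y)) (at y)"
    and "((\<lambda>t. X\<beta> F (x, t)) has_vector_derivative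
          a2 x y *\<^sub>R \<phi> F (x, y) - b2 x y *\<^sub>R \<xi> F (x, y) - c2 x y *\<^sub>R X\<alpha> F (x, y)) (at y)"
proof -
  have "(x, y) \<in> D"
    using assms by (simp add: D_def)
  then show "((\<lambda>s. \<phi> F (s, y)) has_vector_derivative - a1 x y *\<^sub>R X\<alpha> F (x, y)) (at x)"
    "((\<lambda>s. \<xi> F (s, y)) has_vector_derivative b1 x y *\<^sub>R X\<alpha> F (x, y)) (at x)"
    "((\<lambda>s. X\<beta> F (s, y)) has_vector_derivative c1 x y *\<^sub>R X\<alpha> F (x, y)) (at x)"
    "((\<lambda>s. X\<alpha> F (s, y)) has_vector_derivative
          a1 x y *\<^sub>R \<phi> F (x, y) - b1 x y *\<^sub>R \<xi> F (x, y) - c1 x y *\<^sub>R X\<beta> F (x, y)) (at x)"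
    "((\<lambda>t. \<phi> F (x, t)) has_vector_derivative - a2 x y *\<^sub>R X\<beta> F (x, y)) (at y)"
    "((\<lambda>t. \<xi> F (x, t)) has_vector_derivative b2 x y *\<^sub>R X\<beta> F (x, y)) (at y)"
    "((\<lambda>t. X\<alpha> F (x, t)) has_vector_derivative c2 x y *\<^sub>R X\<beta> F (x, y)) (at y)"
    "((\<lambda>t. X\<beta> F (x, t)) has_vector_derivative
          a2 x y *\<^sub>R \<phi> F (x, y) - b2 x y *\<^sub>R \<xi> F (x, y) - c2 x y *\<^sub>R X\<alpha> F (x, y)) (at y)"
    using assms(1) unfolding structure_equations_def has_partial_x_def has_partial_y_def
    by fastforce+
qed

lemma frame_eqI:
  assumes "\<phi> F p = \<phi> G p" "X\<alpha> F p = X\<alpha> G p" "X\<beta> F p = X\<beta> G p" "\<xi> F p = \<xi> G p"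
  shows "F p = G p"
  using assms
  by (simp add: \<phi>_def X\<alpha>_def X\<beta>_def \<xi>_def column_def vec_eq_iff forall_4)

text \<open>By linearity the differences of the columns solve the same skew system. They vanish
  first on the horizontal half-line through (x0, y0), then on every vertical line that meets
  it.\<close>

lemma structure_equations_unique:
  assumes F: "structure_equations F" and G: "structure_equations G"
    and "x0 > 0" "F (x0, y0) = G (x0, y0)" and "x > 0"
  shows "F (x, y) = G (x, y)"
proof -
  let ?d = "\<lambda>c p. c F p - c G p"
  note diff = has_vector_derivative_eq_rhs[OF has_vector_derivative_at_within[OF has_vector_derivative_diff]]
  have "?d \<phi> (x, y0) = 0 \<and> ?d X\<alpha> (x, y0) = 0 \<and> ?d X\<beta> (x, y0) = 0 \<and> ?d \<xi> (x, y0) = 0"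
  proof (rule skew_system_zero[where S = "{0<..}" and ?s0.0 = x0
        and p = "\<lambda>s. ?d \<phi> (s, y0)" and q = "\<lambda>s. ?d X\<alpha> (s, y0)"
        and r = "\<lambda>s. ?d X\<beta> (s, y0)" and w = "\<lambda>s. ?d \<xi> (s, y0)" and a = "\<lambda>s. a1 s y0"
        and b = "\<lambda>s. b1 s y0" and c = "\<lambda>s. c1 s y0"])
    fix s :: real assume "s \<in> {0<..}"
    then have s: "s > 0"
      by simp
    note F = structure_equationsD[OF F s] and G = structure_equationsD[OF G s]
    show "((\<lambda>s. ?d \<phi> (s, y0)) has_vector_derivative - a1 s y0 *\<^sub>R ?d X\<alpha> (s, y0)) (at s within {0<..})"
      by (rule diff[OF F(1) G(1)]) (simp add: algebra_simps)
    show "((\<lambda>s. ?d \<xi> (s, y0)) has_vector_derivative b1 s y0 *\<^sub>R ?d X\<alpha> (s, y0)) (at s within {0<..})"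
      by (rule diff[OF F(2) G(2)]) (simp add: algebra_simps)
    show "((\<lambda>s. ?d X\<beta> (s, y0)) has_vector_derivative c1 s y0 *\<^sub>R ?d X\<alpha> (s, y0)) (at s within {0<..})"
      by (rule diff[OF F(3) G(3)]) (simp add: algebra_simps)
    show "((\<lambda>s. ?d X\<alpha> (s, y0)) has_vector_derivative
        a1 s y0 *\<^sub>R ?d \<phi> (s, y0) - b1 s y0 *\<^sub>R ?d \<xi> (s, y0) - c1 s y0 *\<^sub>R ?d X\<beta> (s, y0)) (at s within {0<..})"
      by (rule diff[OF F(4) G(4)]) (simp add: algebra_simps)
  qed (use assms in \<open>auto simp: \<phi>_def X\<alpha>_def X\<beta>_def \<xi>_def\<close>)
  then have zero: "?d \<phi> (x, y0) = 0" "?d X\<alpha> (x, y0) = 0" "?d X\<beta> (x, y0) = 0" "?d \<xi> (x, y0) = 0"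
    by auto
  note F = structure_equationsD[OF F \<open>x > 0\<close>] and G = structure_equationsD[OF G \<open>x > 0\<close>]
  \<comment> \<open>On vertical lines \<open>X\<alpha>\<close> and \<open>X\<beta>\<close> exchange
    roles; the initial point is now \<open>(x, y0)\<close>.\<close>
  have "?d \<phi> (x, y) = 0 \<and> ?d X\<beta> (x, y) = 0 \<and> ?d X\<alpha> (x, y) = 0 \<and> ?d \<xi> (x, y) = 0"
  proof (rule skew_system_zero[where S = UNIV and ?s0.0 = y0
        and p = "\<lambda>t. ?d \<phi> (x, t)" and q = "\<lambda>t. ?d X\<beta> (x, t)"
        and r = "\<lambda>t. ?d X\<alpha> (x, t)" and w = "\<lambda>t. ?d \<xi> (x, t)" and a = "\<lambda>t. a2 x t"
        and b = "\<lambda>t. b2 x t" and c = "\<lambda>t. c2 x t"])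
    fix t :: real
    show "((\<lambda>t. ?d \<phi> (x, t)) has_vector_derivative - a2 x t *\<^sub>R ?d X\<beta> (x, t)) (at t)"
      by (rule diff[OF F(5) G(5)]) (simp add: algebra_simps)
    show "((\<lambda>t. ?d \<xi> (x, t)) has_vector_derivative b2 x t *\<^sub>R ?d X\<beta> (x, t)) (at t)"
      by (rule diff[OF F(6) G(6)]) (simp add: algebra_simps)
    show "((\<lambda>t. ?d X\<alpha> (x, t)) has_vector_derivative c2 x t *\<^sub>R ?d X\<beta> (x, t)) (at t)"
      by (rule diff[OF F(7) G(7)]) (simp add: algebra_simps)
    show "((\<lambda>t. ?d X\<beta> (x, t)) has_vector_derivative
        a2 x t *\<^sub>R ?d \<phi> (x, t) - b2 x t *\<^sub>R ?d \<xi> (x, t) - c2 x t *\<^sub>R ?d X\<alpha> (x, t)) (at t)"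
      by (rule diff[OF F(8) G(8)]) (simp add: algebra_simps)
  qed (use zero in auto)
  then show ?thesis
    by (intro frame_eqI) auto
qed

section \<open>The reflected frame\<close>

definition reflect :: "(real \<times> real \<Rightarrow> real^4^4) \<Rightarrow> real \<times> real \<Rightarrow> real^4^4" where
  "reflect F = (\<lambda>(x, y). B ** F (x, - y) ** B)"

lemma column_mult_B: "column k (M ** B) = B $ k $ k *\<^sub>R column k M"
  by (auto simp: column_def B_def matrix_matrix_mult_def vec_eq_iff if_distrib cong: if_cong)

lemma reflect_columns:
  "\<phi> (reflect F) (x, y) = - (B *v \<phi> F (x, - y))"
  "X\<alpha> (reflect F) (x, y) = B *v X\<alpha> F (x, - y)"
  "X\<beta> (reflect F) (x, y) = B *v X\<beta> F (x, - y)"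
  "\<xi> (reflect F) (x, y) = B *v \<xi> F (x, - y)"
proof -
  have "column k (B ** M) = B *v column k M" for k and M :: "real^4^4"
    by (simp add: column_def matrix_matrix_mult_def matrix_vector_mult_def vec_eq_iff)
  then show "\<phi> (reflect F) (x, y) = - (B *v \<phi> F (x, - y))"
    "X\<alpha> (reflect F) (x, y) = B *v X\<alpha> F (x, - y)"
    "X\<beta> (reflect F) (x, y) = B *v X\<beta> F (x, - y)"
    "\<xi> (reflect F) (x, y) = B *v \<xi> F (x, - y)"
    by (simp_all add: \<phi>_def X\<alpha>_def X\<beta>_def \<xi>_def reflect_def column_mult_B)
      (simp_all add: B_def)
qed

lemma B_B: "B ** B = mat 1"
  by (simp add: B_def matrix_matrix_mult_def mat_def vec_eq_iff forall_4 sum_4)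

lemma h_minus: "h x (- y) = h x y"
  by (simp add: h_def)

lemma coefficients_minus:
  "a1 x (- y) = - a1 x y" "b1 x (- y) = b1 x y" "c1 x (- y) = c1 x y"
  "a2 x (- y) = a2 x y" "b2 x (- y) = - b2 x y" "c2 x (- y) = - c2 x y"
  by (simp_all add: a1_def b1_def c1_def a2_def b2_def c2_def h_minus)

lemma B_mult_has_vector_derivative:
  assumes "(g has_vector_derivative v) F"
  shows "((\<lambda>s. B *v g s) has_vector_derivative B *v v) F"
  by (rule bounded_linear.has_vector_derivative[OF matrix_vector_mul_bounded_linear assms])

lemma has_vector_derivative_reflect:
  assumes "(g has_vector_derivative v) (at (- t))"
  shows "((\<lambda>t. g (- t)) has_vector_derivative - v) (at (t::real))"
proof -
  have "((g \<circ> uminus) has_vector_derivative (- 1) *\<^sub>R v) (at t)"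
    using assms by (intro vector_diff_chain_at) (auto intro!: derivative_eq_intros)
  then show ?thesis
    by (simp add: o_def)
qed

text \<open>The signs balance. In the x-equations only \<open>a1\<close> is odd in y, and it couples
  exactly to the column \<phi>, whose sign the right factor \<open>B\<close> reverses. In the
  y-equations the chain rule produces a minus sign, absorbed by the oddness of \<open>b2\<close> and
  \<open>c2\<close>, and for the even coefficient \<open>a2\<close> by the sign of \<phi>.\<close>

lemma structure_equations_reflect:
  assumes "structure_equations F"
  shows "structure_equations (reflect F)"
  unfolding structure_equations_def has_partial_x_def has_partial_y_def fst_conv snd_conv
proof (clarify)
  fix x y assume "(x, y) \<in> D"
  then have x: "x > 0"
    by (simp add: D_def)
  note F = structure_equationsD[OF assms x]
  note lin = matrix_vector_mult_diff_distrib matrix_vector_mult_scaleR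
    vec.neg
  show "((\<lambda>s. \<phi> (reflect F) (s, y)) has_vector_derivative
          - a1 x y *\<^sub>R X\<alpha> (reflect F) (x, y)) (at x) \<and>
       ((\<lambda>s. \<xi> (reflect F) (s, y)) has_vector_derivative
          b1 x y *\<^sub>R X\<alpha> (reflect F) (x, y)) (at x) \<and>
       ((\<lambda>s. X\<beta> (reflect F) (s, y)) has_vector_derivative
          c1 x y *\<^sub>R X\<alpha> (reflect F) (x, y)) (at x) \<and>
       ((\<lambda>s. X\<alpha> (reflect F) (s, y)) has_vector_derivative
          a1 x y *\<^sub>R \<phi> (reflect F) (x, y) - b1 x y *\<^sub>R \<xi> (reflect F) (x, y)
            - c1 x y *\<^sub>R X\<beta> (reflect F) (x, y)) (at x) \<and>
       ((\<lambda>t. \<phi> (reflect F) (x, t)) has_vector_derivative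
          - a2 x y *\<^sub>R X\<beta> (reflect F) (x, y)) (at y) \<and>
       ((\<lambda>t. \<xi> (reflect F) (x, t)) has_vector_derivative
          b2 x y *\<^sub>R X\<beta> (reflect F) (x, y)) (at y) \<and>
       ((\<lambda>t. X\<alpha> (reflect F) (x, t)) has_vector_derivative
          c2 x y *\<^sub>R X\<beta> (reflect F) (x, y)) (at y) \<and>
       ((\<lambda>t. X\<beta> (reflect F) (x, t)) has_vector_derivative
          a2 x y *\<^sub>R \<phi> (reflect F) (x, y) - b2 x y *\<^sub>R \<xi> (reflect F) (x, y)
            - c2 x y *\<^sub>R X\<alpha> (reflect F) (x, y)) (at y)"
    unfolding reflect_columns
    using F[of "- y", THEN B_mult_has_vector_derivative]
      F(1)[of "- y", THEN B_mult_has_vector_derivative, THEN has_vector_derivative_minus]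
      F(5)[of "- y", THEN has_vector_derivative_reflect, THEN B_mult_has_vector_derivative,
        THEN has_vector_derivative_minus]
      F(6-8)[of "- y", THEN has_vector_derivative_reflect, THEN B_mult_has_vector_derivative]
    by (simp add: coefficients_minus lin)
qed

section \<open>Symmetry of the surface and of the spheres\<close>

lemma curvature_surfaceD:
  assumes "curvature_surface F f" "x > 0"
  shows "(f has_derivative
          (\<lambda>(dx, dy). ((x^2 - y^2) / (x * h x y) * dx) *\<^sub>R X\<alpha> F (x, y)
                     + (2 * y / h x y * dy) *\<^sub>R X\<beta> F (x, y))) (at (x, y))"
  using assms by (auto simp: curvature_surface_def D_def)

text \<open>Both sides have the same differential: the coefficient of dx is even in y, while that of
  dy is odd and meets the sign change of dy. The difference is therefore constant on the convex set
  \<open>D\<close>, and it vanishes at the base point, which the reflection fixes.\<close>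

lemma curvature_surface_reflect:
  assumes f: "curvature_surface F f"
    and F: "\<And>x y. x > 0 \<Longrightarrow> reflect F (x, y) = F (x, y)"
    and "x0 > 0" "f (x0, 0) = 0" "x > 0"
  shows "B *v f (x, - y) = f (x, y)"
proof -
  define g where "g p = B *v f (fst p, - snd p) - f p" for p
  have deriv: "(g has_derivative (\<lambda>_. 0)) (at p within D)" if "p \<in> D" for p
  proof -
    obtain s t where p: "p = (s, t)"
      by (cases p)
    with that have s: "s > 0"
      by (simp add: D_def)
    have cols: "B *v X\<alpha> F (s, - t) = X\<alpha> F (s, t)" "B *v X\<beta> F (s, - t) = X\<beta> F (s, t)"
      using reflect_columns[of F s t] F[OF s, of t] by (simp_all add: X\<alpha>_def X\<beta>_def)
    have r: "((\<lambda>p. (fst p, - snd p)) has_derivative (\<lambda>p. (fst p, - snd p))) (at (s, t))"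
      by (auto intro!: derivative_eq_intros)
    have "((\<lambda>p. f (fst p, - snd p)) has_derivative
        (\<lambda>p. ((s^2 - t^2) / (s * h s t) * fst p) *\<^sub>R X\<alpha> F (s, - t)
           + (2 * t / h s t * snd p) *\<^sub>R X\<beta> F (s, - t))) (at (s, t))"
      using has_derivative_compose[OF r, of f] curvature_surfaceD[OF f s, of "- t"]
      by (fastforce simp: h_minus case_prod_beta)
    from bounded_linear.has_derivative[OF matrix_vector_mul_bounded_linear this, of B]
    have "((\<lambda>p. B *v f (fst p, - snd p)) has_derivative
        (\<lambda>p. ((s^2 - t^2) / (s * h s t) * fst p) *\<^sub>R X\<alpha> F (s, t)
           + (2 * t / h s t * snd p) *\<^sub>R X\<beta> F (s, t))) (at (s, t))"
      by (simp add: matrix_vector_right_distrib matrix_vector_mult_scaleR cols)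
    from has_derivative_diff[OF this curvature_surfaceD[OF f s, of t]]
    have "(g has_derivative (\<lambda>_. 0)) (at (s, t))"
      unfolding g_def[abs_def] by (simp add: case_prod_beta)
    then show ?thesis
      unfolding p by (rule has_derivative_at_withinI)
  qed
  have "convex D"
  proof -
    have "convex ({0<..} \<times> UNIV :: (real \<times> real) set)"
      by (intro convex_Times convex_real_interval convex_UNIV)
    also have "{0<..} \<times> UNIV = D"
      by (auto simp: D_def)
    finally show ?thesis .
  qed
  then have "\<exists>k. \<forall>p\<in>D. g p = k"
    by (rule has_derivative_zero_constant) (rule deriv)
  moreover have "(x, y) \<in> D" "(x0, 0) \<in> D"
    using assms by (simp_all add: D_def)
  ultimately have "g (x, y) = g (x0, 0)"
    by metis
  then show ?thesis
    using assms by (simp add: g_def)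
qed

section \<open>Constancy of the normals and centers along the y-curves\<close>

lemma constant_if_has_vector_derivative_zero:
  fixes g :: "real \<Rightarrow> 'a::real_normed_vector"
  assumes "\<And>t. (g has_vector_derivative 0) (at t)"
  shows "g t = g s"
proof -
  have "\<exists>k. \<forall>t\<in>UNIV. g t = k"
    using has_derivative_zero_constant[of UNIV g] assms
    by (simp add: has_vector_derivative_def)
  then show ?thesis
    by (metis UNIV_I)
qed

text \<open>The common factor 2y/h is also the coefficient of \<open>X\<beta>\<close> in the
  y-derivative of the surface, so along a y-curve all relevant derivatives are this factor times
  \<open>X\<beta>\<close> times a function of x.\<close>

lemma b2_c2_eq: "b2 x y = 2 * y / h x y * B2 x" "c2 x y = 2 * y / h x y * C2 x"
proof -
  have "X0' x / (2 * x) + sqrt 5 = - B2 x"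
    by (simp add: B2_def)
  then show "b2 x y = 2 * y / h x y * B2 x"
    by (simp add: b2_def)
  show "c2 x y = 2 * y / h x y * C2 x"
    by (simp add: c2_def C2_def)
qed

text \<open>The y-derivative is a multiple of \<open>X\<beta>\<close> with coefficient -B2 c2 + C2
  b2 up to the normalization, and this cancels because (b2, c2) is proportional to (B2, C2).\<close>

lemma u_tilde_constant:
  assumes "structure_equations F" "x > 0"
  shows "u_tilde F (x, y) = u_tilde F (x, y')"
proof -
  have "((\<lambda>t. - B2 x *\<^sub>R X\<alpha> F (x, t) + C2 x *\<^sub>R \<xi> F (x, t)) has_vector_derivative 0) (at t)" for t
  proof -
    have "- B2 x * c2 x t + C2 x * b2 x t = 0"
      by (simp add: b2_c2_eq)
    then have "- B2 x *\<^sub>R c2 x t *\<^sub>R X\<beta> F (x, t) + C2 x *\<^sub>R b2 x t *\<^sub>R X\<beta> F (x, t) = 0"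
      by (simp only: scaleR_scaleR scaleR_add_left[symmetric] scaleR_zero_left)
    moreover have "((\<lambda>t. - B2 x *\<^sub>R X\<alpha> F (x, t) + C2 x *\<^sub>R \<xi> F (x, t)) has_vector_derivative
        - B2 x *\<^sub>R c2 x t *\<^sub>R X\<beta> F (x, t) + C2 x *\<^sub>R b2 x t *\<^sub>R X\<beta> F (x, t)) (at t)"
      by (intro has_vector_derivative_add
          bounded_linear.has_vector_derivative[OF bounded_linear_scaleR_right]
          structure_equationsD[OF assms])
    ultimately show ?thesis
      by (simp only:)
  qed
  from constant_if_has_vector_derivative_zero[OF this, of y y'] show ?thesis
    by (simp add: u_tilde_def)
qed

text \<open>The derivative of the correction term is (2y/h)(B2^2 + C2^2)/(B2^2 + C2^2) times
  \<open>X\<beta>\<close>, which is exactly the y-derivative of the surface.\<close>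

lemma A_tilde_constant:
  assumes "structure_equations F" "curvature_surface F f" "x > 0"
  shows "A_tilde F f (x, y) = A_tilde F f (x, y')"
proof -
  let ?k = "inverse ((B2 x)^2 + (C2 x)^2)"
  have "((\<lambda>t. A_tilde F f (x, t)) has_vector_derivative 0) (at t)" for t
  proof -
    have "((\<lambda>t. (x, t)) has_derivative (\<lambda>d. (0, d))) (at t)"
      by (auto intro!: derivative_eq_intros)
    from has_derivative_compose[OF this curvature_surfaceD[OF assms(2,3)]]
    have f: "((\<lambda>t. f (x, t)) has_vector_derivative (2 * t / h x t) *\<^sub>R X\<beta> F (x, t)) (at t)"
      by (simp add: has_vector_derivative_def mult.commute)
    have "?k * (B2 x * b2 x t + C2 x * c2 x t) = 2 * t / h x t * (?k * ((B2 x)^2 + (C2 x)^2))"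
      unfolding b2_c2_eq by (simp only: algebra_simps power2_eq_square)
    also have "?k * ((B2 x)^2 + (C2 x)^2) = 1"
      using B2_C2_pos[OF assms(3)] by (intro left_inverse less_imp_neq[symmetric])
    finally have "(2 * t / h x t) *\<^sub>R X\<beta> F (x, t)
        - ?k *\<^sub>R (B2 x *\<^sub>R b2 x t *\<^sub>R X\<beta> F (x, t) + C2 x *\<^sub>R c2 x t *\<^sub>R X\<beta> F (x, t)) = 0"
      by (simp only: scaleR_scaleR scaleR_add_left[symmetric]) simp
    moreover have "((\<lambda>t. A_tilde F f (x, t)) has_vector_derivative (2 * t / h x t) *\<^sub>R X\<beta> F (x, t)
        - ?k *\<^sub>R (B2 x *\<^sub>R b2 x t *\<^sub>R X\<beta> F (x, t) + C2 x *\<^sub>R c2 x t *\<^sub>R X\<beta> F (x, t))) (at t)"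
      unfolding A_tilde_def split_conv
      by (intro has_vector_derivative_add has_vector_derivative_diff f
          bounded_linear.has_vector_derivative[OF bounded_linear_scaleR_right]
          structure_equationsD[OF assms(1,3)])
    ultimately show ?thesis
      by (simp only:)
  qed
  then show ?thesis
    by (rule constant_if_has_vector_derivative_zero)
qed

theorem corollary3p10:
  fixes F :: "real \<times> real \<Rightarrow> real^4^4"
    and f :: "real \<times> real \<Rightarrow> real^4"
    and x0 :: real
  assumes "frame_field F"
    and "curvature_surface F f"
    and "(x0, 0) \<in> D"
    and "f (x0, 0) = 0"
    and "F (x0, 0) = mat 1"
  shows "(\<forall>x>0. \<forall>y\<ge>0.
            B *v f (x, y) = f (x, - y) \<and>
            B *v \<phi> F (x, y) = - \<phi> F (x, - y) \<and>
            B *v \<xi> F (x, y) = \<xi> F (x, - y)) \<and>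
         (\<exists>u A :: real \<Rightarrow> real^4. \<forall>x>0.
            (\<forall>y. u_tilde F (x, y) = u x \<and> A_tilde F f (x, y) = A x) \<and>
            B *v u x = u x \<and>
            B *v A x = A x)"
proof -
  have x0: "x0 > 0"
    using assms(3) by (simp add: D_def)
  have F: "structure_equations F"
    using assms(1) by (rule frame_field_structure_equations)
  \<comment> \<open>The two frames agree at (x0, 0): the reflection fixes this point and conjugation
    by \<open>B\<close> fixes the identity, as \<open>B\<close> is an involution.\<close>
  have reflect: "reflect F (x, y) = F (x, y)" if "x > 0" for x y
    using structure_equations_reflect[OF F] F x0 _ that
    by (rule structure_equations_unique[where ?y0.0 = 0]) (simp add: reflect_def assms(5) B_B)
  have f: "B *v f (x, y) = f (x, - y)" if "x > 0" for x y
    using curvature_surface_reflect[OF assms(2) reflect x0 assms(4) that, of "- y"] by simp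
  have cols: "B *v \<phi> F (x, y) = - \<phi> F (x, - y)" "B *v X\<alpha> F (x, y) = X\<alpha> F (x, - y)"
    "B *v \<xi> F (x, y) = \<xi> F (x, - y)" if "x > 0" for x y
    using reflect_columns[of F x "- y"] reflect[OF that, of "- y"]
    by (simp_all add: \<phi>_def X\<alpha>_def \<xi>_def minus_equation_iff)
  \<comment> \<open>On the axis y = 0 the symmetries say that \<open>B\<close> fixes the surface
    point, \<open>X\<alpha>\<close> and \<xi> themselves, hence every combination of them;
    independence of y then removes the restriction to the axis.\<close>
  have "B *v u_tilde F (x, 0) = u_tilde F (x, 0)" "B *v A_tilde F f (x, 0) = A_tilde F f (x, 0)"
    if "x > 0" for x
    using cols[OF that, of 0] f[OF that, of 0]
    by (simp_all add: u_tilde_def A_tilde_def matrix_vector_right_distrib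
        matrix_vector_mult_diff_distrib matrix_vector_mult_scaleR)
  moreover have "u_tilde F (x, y) = u_tilde F (x, 0) \<and> A_tilde F f (x, y) = A_tilde F f (x, 0)"
    if "x > 0" for x y
    by (intro conjI u_tilde_constant[OF F that] A_tilde_constant[OF F assms(2) that])
  ultimately have "\<forall>x>0. (\<forall>y. u_tilde F (x, y) = u_tilde F (x, 0) \<and> A_tilde F f (x, y) = A_tilde F f (x, 0)) \<and>
      B *v u_tilde F (x, 0) = u_tilde F (x, 0) \<and> B *v A_tilde F f (x, 0) = A_tilde F f (x, 0)"
    by blast
  then have "\<exists>u A :: real \<Rightarrow> real^4. \<forall>x>0.
      (\<forall>y. u_tilde F (x, y) = u x \<and> A_tilde F f (x, y) = A x) \<and> B *v u x = u x \<and> B *v A x = A x"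
    by (rule exI[of _ "\<lambda>x. u_tilde F (x, 0)", OF exI[of _ "\<lambda>x. A_tilde F f (x, 0)"]])
  with f cols(1,3) show ?thesis
    by simp
qed

end
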